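(* Let $G$ be a graph with $n$ vertices, with largest eigenvalue $\lambda_1>0$ and nullity $\eta(G)=\kappa$. Then $$\mathcal{E}(G)\ \geq\ \lambda_1+n-\kappa-1+\ln\bigl|\Upsilon_{n-\kappa}(G)\bigr|-\ln\lambda_1 .$$ Equality holds if and only if the nonzero eigenvalues of $G$, except maybe for its largest eigenvalue, all have modulus equal to $1$. In the case of equality: if the largest eigenvalue of $G$ is $1$, then $G=\lfloor\frac{n-\kappa}{2}\rfloor K_2\cup\kappa K_1$; on the contrary, if $\lambda_1>1$, then $G=K_{n-\ell}\cup\kappa K_1\cup\lfloor\frac{\ell-\kappa}{2}\rfloor K_2$ for some $\ell$ with $\kappa\leq\ell\leq n-3$.
   Context: Graphs are finite, undirected and simple. The eigenvalues of $G$ are those of its adjacency matrix $A(G)$. The energy $\mathcal{E}(G)$ is the sum of the absolute values of the eigenvalues of $G$, counted with multiplicity. The nullity $\eta(G)$ is the multiplicity of $0$ as an eigenvalue of $A(G)$. For a square matrix $M$ of order $n$ with eigenvalues $\mu_1,\dots,\mu_n$, $\Upsilon_k(M)=\sum_{1\le i_1<\cdots<i_k\le n}\mu_{i_1}\cdots\mu_{i_k}$, and $\Upsilon_{n-\kappa}(G)=\Upsilon_{n-\kappa}(A(G))$. $K_s$ is the complete graph on $s$ vertices, $tH$ denotes the disjoint union of $t$ copies of $H$ (empty if $t=0$), $\cup$ denotes disjoint union, and equality of graphs means isomorphism. Eigenvalues are counted with multiplicity; "except maybe for its largest eigenvalue" means that one copy of $\lambda_1$ is removed from the list of nonzero eigenvalues.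 *)

theory Defs
  imports "Jordan_Normal_Form.Char_Poly"
    "HOL-Computational_Algebra.Fundamental_Theorem_Algebra"
begin

record 'a graph =
  verts :: "'a set"
  edges :: "'a set set"

definition simple_graph :: "'a graph \<Rightarrow> bool" where
  "simple_graph G \<longleftrightarrow> finite (verts G) \<and> (\<forall>e\<in>edges G. e \<subseteq> verts G \<and> card e = 2)"

definition graph_iso :: "'a graph \<Rightarrow> 'b graph \<Rightarrow> bool" (infix "\<simeq>\<^sub>g" 50) where
  "G \<simeq>\<^sub>g H \<longleftrightarrow> (\<exists>f. bij_betw f (verts G) (verts H) \<and>
     (\<forall>u\<in>verts G. \<forall>v\<in>verts G. {u, v} \<in> edges G \<longleftrightarrow> {f u, f v} \<in> edges H))"

definition complete_graph :: "nat \<Rightarrow> nat graph" where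
  "complete_graph s = \<lparr>verts = {..<s}, edges = {e. e \<subseteq> {..<s} \<and> card e = 2}\<rparr>"

definition disjoint_union :: "'a graph \<Rightarrow> 'b graph \<Rightarrow> ('a + 'b) graph" (infixr "\<uplus>\<^sub>g" 65) where
  "G \<uplus>\<^sub>g H = \<lparr>verts = verts G <+> verts H,
              edges = (\<lambda>e. Inl ` e) ` edges G \<union> (\<lambda>e. Inr ` e) ` edges H\<rparr>"

definition copies :: "nat \<Rightarrow> 'a graph \<Rightarrow> (nat \<times> 'a) graph" (infixr "\<cdot>\<^sub>g" 70) where
  "t \<cdot>\<^sub>g H = \<lparr>verts = {..<t} \<times> verts H,
             edges = (\<Union>i\<in>{..<t}. (\<lambda>e. Pair i ` e) ` edges H)\<rparr>"

text \<open>Only the roots in the ground ring are counted, so this is the full list of eigenvalues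
  (of length the order of the matrix) when the characteristic polynomial splits there: always
  over the complex numbers, and over the reals for symmetric matrices
  (see \<open>size_proots_char_poly_symmetric\<close> below).\<close>

definition eigenvalues :: "'a::idom mat \<Rightarrow> 'a multiset" where
  "eigenvalues M = proots (char_poly M)"

text \<open>The sum is symmetric in the eigenvalues, so the chosen listing does not matter.\<close>

definition Upsilon :: "nat \<Rightarrow> 'a::idom mat \<Rightarrow> 'a" where
  "Upsilon k M = (let \<mu> = (SOME xs. mset xs = eigenvalues M) in
     \<Sum>I | I \<subseteq> {..<length \<mu>} \<and> card I = k. \<Prod>i\<in>I. \<mu> ! i)"

text \<open>The spectrum does not depend on the chosen enumeration of the vertices, since any two
  enumerations give permutation-similar matrices.\<close>

definition vertex_list :: "'a graph \<Rightarrow> 'a list" where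
  "vertex_list G = (SOME xs. set xs = verts G \<and> distinct xs)"

definition adj_matrix :: "'a graph \<Rightarrow> real mat" where
  "adj_matrix G = (let xs = vertex_list G in
     mat (card (verts G)) (card (verts G)) (\<lambda>(i, j). if {xs ! i, xs ! j} \<in> edges G then 1 else 0))"

definition graph_eigenvalues :: "'a graph \<Rightarrow> real multiset" where
  "graph_eigenvalues G = eigenvalues (adj_matrix G)"

text \<open>Relational rather than via a maximum, so that it is never satisfied when there are no vertices.\<close>

definition is_largest_eigenvalue :: "'a graph \<Rightarrow> real \<Rightarrow> bool" where
  "is_largest_eigenvalue G x \<longleftrightarrow>
     x \<in># graph_eigenvalues G \<and> (\<forall>\<mu>\<in>#graph_eigenvalues G. \<mu> \<le> x)"

definition energy :: "'a graph \<Rightarrow> real" where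
  "energy G = (\<Sum>\<mu>\<in>#graph_eigenvalues G. \<bar>\<mu>\<bar>)"

definition nullity :: "'a graph \<Rightarrow> nat" where
  "nullity G = count (graph_eigenvalues G) 0"

definition graph_Upsilon :: "nat \<Rightarrow> 'a graph \<Rightarrow> real" where
  "graph_Upsilon k G = Upsilon k (adj_matrix G)"

lemma size_proots_real_if_complex_roots_real:
  fixes p :: "real poly"
  assumes "p \<noteq> 0" "\<And>z. poly (map_poly complex_of_real p) z = 0 \<Longrightarrow> z \<in> \<real>"
  shows "size (proots p) = degree p"
  using assms
proof (induction "degree p" arbitrary: p)
  case 0
  then obtain c where "p = [:c:]" by (metis degree_eq_zeroE)
  then show ?case by simp
next
  case (Suc d)
  interpret hom: map_poly_comm_ring_hom complex_of_real ..
  let ?c = "map_poly complex_of_real"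
  have "degree (?c p) = Suc d"
    using Suc.hyps(2) by simp
  then have "\<not> constant (poly (?c p))"
    by (simp add: constant_degree)
  then obtain z where z: "poly (?c p) z = 0"
    using fundamental_theorem_of_algebra by blast
  with Suc.prems(2) obtain r where r: "z = complex_of_real r"
    by (auto elim: Reals_cases)
  have "poly p r = 0"
    using z by (simp add: r)
  then obtain q where q: "p = [:- r, 1:] * q"
    by (auto simp: poly_eq_0_iff_dvd elim: dvdE)
  with Suc.prems(1) have "q \<noteq> 0" by auto
  then have dq: "degree p = Suc (degree q)"
    unfolding q by (subst degree_mult_eq) auto
  have "size (proots q) = degree q"
  proof (rule Suc.hyps(1))
    show "d = degree q" using dq Suc.hyps(2) by simp
    show "q \<noteq> 0" by fact
    fix w assume "poly (?c q) w = 0"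
    then have "poly (?c p) w = 0"
      unfolding q hom.hom_mult by simp
    then show "w \<in> \<real>" by (rule Suc.prems(2))
  qed
  moreover have "proots p = {#r#} + proots q"
    unfolding q using \<open>q \<noteq> 0\<close> by (subst proots_mult) auto
  ultimately show ?case by (simp add: dq)
qed

lemma eigenvalue_symmetric_real:
  fixes A :: "real mat"
  assumes A: "A \<in> carrier_mat n n"
    and sym: "\<And>i j. i < n \<Longrightarrow> j < n \<Longrightarrow> A $$ (i, j) = A $$ (j, i)"
    and ev: "eigenvalue (map_mat complex_of_real A) k"
  shows "k \<in> \<real>"
proof -
  let ?B = "map_mat complex_of_real A"
  obtain v where v: "v \<in> carrier_vec n" "v \<noteq> 0\<^sub>v n" "?B *\<^sub>v v = k \<cdot>\<^sub>v v"
    using ev A unfolding eigenvalue_def eigenvector_def by auto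
  have row: "(\<Sum>j<n. A $$ (i, j) * v $ j) = k * v $ i" if "i < n" for i
  proof -
    have "(?B *\<^sub>v v) $ i = (\<Sum>j<n. A $$ (i, j) * v $ j)"
      using that A v(1) by (auto simp: scalar_prod_def atLeast0LessThan intro!: sum.cong)
    then show ?thesis using v that by simp
  qed
  let ?S = "\<Sum>i<n. \<Sum>j<n. cnj (v $ i) * A $$ (i, j) * v $ j"
  let ?N = "\<Sum>i<n. (cmod (v $ i))\<^sup>2"
  have S: "?S = k * of_real ?N"
  proof -
    have "?S = (\<Sum>i<n. cnj (v $ i) * (\<Sum>j<n. A $$ (i, j) * v $ j))"
      by (simp add: sum_distrib_left mult.assoc)
    also have "\<dots> = (\<Sum>i<n. k * of_real ((cmod (v $ i))\<^sup>2))"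
      by (intro sum.cong) (auto simp: row complex_norm_square simp del: of_real_power)
    finally show ?thesis by (simp add: sum_distrib_left)
  qed
  have "cnj ?S = (\<Sum>i<n. \<Sum>j<n. cnj (v $ j) * A $$ (j, i) * v $ i)"
    by (auto simp: sym intro!: sum.cong)
  also have "\<dots> = ?S" by (rule sum.swap)
  finally have "cnj (k * of_real ?N) = k * of_real ?N"
    unfolding S .
  moreover have "?N \<noteq> 0"
  proof
    assume "?N = 0"
    then have "\<forall>i<n. v $ i = 0" by (simp add: sum_nonneg_eq_0_iff)
    then have "v = 0\<^sub>v n" using v(1) by auto
    then show False using v(2) by simp
  qed
  ultimately have "cnj k = k"
    by (metis complex_cnj_complex_of_real complex_cnj_mult mult_cancel_right of_real_eq_0_iff)
  then show ?thesis by (simp add: Reals_cnj_iff)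
qed

lemma size_proots_char_poly_symmetric:
  fixes A :: "real mat"
  assumes A: "A \<in> carrier_mat n n"
    and sym: "\<And>i j. i < n \<Longrightarrow> j < n \<Longrightarrow> A $$ (i, j) = A $$ (j, i)"
  shows "size (eigenvalues A) = n"
proof -
  have deg: "degree (char_poly A) = n" and monic: "monic (char_poly A)"
    using degree_monic_char_poly[OF A] by auto
  have "size (proots (char_poly A)) = degree (char_poly A)"
  proof (rule size_proots_real_if_complex_roots_real)
    show "char_poly A \<noteq> 0" using monic by auto
    fix z assume "poly (map_poly complex_of_real (char_poly A)) z = 0"
    then have "eigenvalue (map_mat complex_of_real A) z"
      using A by (subst eigenvalue_root_char_poly[of _ n]) (auto simp: of_real_hom.char_poly_hom[OF A])
    then show "z \<in> \<real>" using eigenvalue_symmetric_real[OF A sym] by blast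
  qed
  then show ?thesis by (simp add: eigenvalues_def deg)
qed

lemma size_graph_eigenvalues: "size (graph_eigenvalues G) = card (verts G)"
  unfolding graph_eigenvalues_def
  by (rule size_proots_char_poly_symmetric)
    (auto simp: adj_matrix_def Let_def insert_commute)

end

(* The inequality is t - 1 >= ln t, applied to the moduli of the non-zero eigenvalues other than one
   copy of lam1, whose product with lam1 is Upsilon_{n - kappa}.

   In the case of equality all eigenvalues are at least -1, so A + I is positive semidefinite and no
   path on three vertices is induced: G is a disjoint union of cliques. Moreover A^3 - A has rank at
   most one, so at most one clique has three or more vertices. The trace of A^3 - A gives the size
   of that clique, and the trace of I - A^2 gives the number of isolated vertices. *)
theory Submission
  imports Defs "Jordan_Normal_Form.Schur_Decomposition"
begin

text \<open>The bound keeps lam1 - ln lam1 as it stands, so the estimate is never applied to that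
  copy of lam1. For the structure of G, neither the spectrum of a clique nor that of a disjoint
  union is computed. A polynomial f(A) is evaluated twice instead: through the eigenbasis, and
  entrywise. Once nearness is transitive, A + I is block diagonal with all-ones blocks J, and J^k =
  m^(k-1) J for a block of order m, so the entries of f(A) depend only on clique sizes. The two
  polynomials are chosen to isolate one unknown each. x^3 - x vanishes at -1, 0 and 1, leaving only
  lam1 on the spectral side, and it gives m(m-1)(m-2) as the trace on a clique of m vertices,
  leaving only the large one. 1 - x^2 vanishes at -1 and 1 and is 1 at 0, so it counts zeros; its
  trace on a clique is m(2-m), which is 1 for an isolated vertex, 0 for an edge, and 1 - (m-1)^2 for
  the large clique, where it cancels the term of lam1 = m-1.\<close>

section \<open>Spectral decomposition of real symmetric matrices\<close>

text \<open>Gram-Schmidt leaves the first vector of the completed basis unchanged. Its output is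
  orthogonal but not normalised, hence the division by \<open>N\<close> and the scalar
  \<open>c\<close>.\<close>

lemma orthonormal_matrix_with_first_column:
  fixes v :: "real vec"
  assumes v: "v \<in> carrier_vec n" "v \<noteq> 0\<^sub>v n"
  obtains W c where "W \<in> carrier_mat n n" "W\<^sup>T * W = 1\<^sub>m n" "col W 0 = c \<cdot>\<^sub>v v"
proof -
  interpret cof_vec_space n "TYPE(real)" .
  define b where "b = basis_completion v"
  define ws where "ws = gram_schmidt n b"
  note bc = basis_completion[OF v, folded b_def]
  have n: "n \<noteq> 0" using v by (cases n) auto
  have len_b: "length b = n" and hd_b: "hd b = v" using bc by auto
  then obtain vs where "b = v # vs" using n by (cases b) auto
  then have hd_ws: "hd ws = v" using v unfolding ws_def by simp
  have ws: "corthogonal ws" "set ws \<subseteq> carrier_vec n" "length ws = n"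
    using gram_schmidt_result[OF bc(2,4,5) refl, folded ws_def] len_b by auto
  have dim: "ws ! i \<in> carrier_vec n" if "i < n" for i
    using ws that by (simp add: subset_iff)
  \<comment> \<open>Over the reals \<open>corthogonal\<close> is ordinary orthogonality, together
    with non-zero norms.\<close>
  have orth: "ws ! i \<bullet> ws ! j = 0 \<longleftrightarrow> i \<noteq> j" if "i < n" "j < n" for i j
    using corthogonalD[OF ws(1), of i j] ws(3) that by (simp add: conjugate_vec_def vec_eq_iff)
  define N where "N i = sqrt (ws ! i \<bullet> ws ! i)" for i
  have pos: "ws ! i \<bullet> ws ! i > 0" if "i < n" for i
  proof -
    have "ws ! i \<bullet> ws ! i \<ge> 0" by (simp add: scalar_prod_def sum_nonneg)
    then show ?thesis using orth[OF that that] by linarith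
  qed
  define W where "W = mat n n (\<lambda>(i, j). ws ! j $ i / N j)"
  have W: "W \<in> carrier_mat n n" by (simp add: W_def)
  have "(W\<^sup>T * W) $$ (i, j) = (1\<^sub>m n :: real mat) $$ (i, j)" if ij: "i < n" "j < n" for i j
  proof -
    have "(W\<^sup>T * W) $$ (i, j) = (\<Sum>k = 0..<n. ws ! i $ k * ws ! j $ k / (N i * N j))"
      using ij by (simp add: W_def scalar_prod_def)
    also have "\<dots> = (ws ! i \<bullet> ws ! j) / (N i * N j)"
      using dim[OF ij(2)] by (simp add: scalar_prod_def sum_divide_distrib)
    also have "\<dots> = (1\<^sub>m n :: real mat) $$ (i, j)"
      using orth[OF ij] pos[OF ij(1)] ij by (cases "i = j") (auto simp: N_def)
    finally show ?thesis .
  qed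
  then have "W\<^sup>T * W = 1\<^sub>m n" using W by (intro eq_matI) auto
  moreover have "ws ! 0 = v" using hd_ws ws(3) n by (metis hd_conv_nth length_0_conv)
  then have "col W 0 = (1 / N 0) \<cdot>\<^sub>v v"
    using n v by (intro eq_vecI) (auto simp: W_def)
  ultimately show ?thesis using that W by blast
qed

lemma transpose_conjugate_symmetric:
  fixes A :: "real mat"
  assumes "A \<in> carrier_mat n n" "A\<^sup>T = A" "W \<in> carrier_mat n m"
  shows "(W\<^sup>T * A * W)\<^sup>T = W\<^sup>T * A * W"
proof -
  have "(W\<^sup>T * A * W)\<^sup>T = W\<^sup>T * (W\<^sup>T * A)\<^sup>T"
    by (rule transpose_mult[of _ m n _ m]) (use assms in auto)
  also have "(W\<^sup>T * A)\<^sup>T = A * W"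
    using assms transpose_mult[of "W\<^sup>T" m n A n] by simp
  also have "W\<^sup>T * (A * W) = W\<^sup>T * A * W"
    by (rule assoc_mult_mat[symmetric, of _ m n _ n _ m]) (use assms in auto)
  finally show ?thesis .
qed

text \<open>Deflation: an orthonormal basis that begins with an eigenvector clears the rest of the
  first column, symmetry clears the first row, and the remaining block is symmetric of smaller
  order. A real eigenvector exists because the characteristic polynomial of a symmetric matrix
  splits over the reals.\<close>

theorem real_symmetric_diagonalisation:
  fixes A :: "real mat"
  assumes "A \<in> carrier_mat n n" "A\<^sup>T = A"
  shows "\<exists>U \<in> carrier_mat n n. U\<^sup>T * U = 1\<^sub>m n \<and> diagonal_mat (U\<^sup>T * A * U)"
  using assms
proof (induction n arbitrary: A)
  case 0
  then show ?case by (intro bexI[of _ "1\<^sub>m 0"]) (auto simp: diagonal_mat_def)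
next
  case (Suc m)
  note A = Suc.prems(1) and sym = Suc.prems(2)
  have "A $$ (i, j) = A $$ (j, i)" if "i < Suc m" "j < Suc m" for i j
    using sym A that by (metis carrier_matD index_transpose_mat(1))
  then have "size (eigenvalues A) = Suc m"
    by (rule size_proots_char_poly_symmetric[OF A])
  then obtain e where "e \<in># eigenvalues A"
    by (metis multiset_nonemptyE size_empty Zero_not_Suc)
  moreover have "char_poly A \<noteq> 0"
    using degree_monic_char_poly[OF A] by auto
  ultimately have "eigenvalue A e"
    unfolding eigenvalue_root_char_poly[OF A] by (simp add: eigenvalues_def)
  then obtain v where v: "v \<in> carrier_vec (Suc m)" "v \<noteq> 0\<^sub>v (Suc m)" "A *\<^sub>v v = e \<cdot>\<^sub>v v"
    using A unfolding eigenvalue_def eigenvector_def by auto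
  from orthonormal_matrix_with_first_column[OF v(1,2)] obtain W c
    where W: "W \<in> carrier_mat (Suc m) (Suc m)" and WW: "W\<^sup>T * W = 1\<^sub>m (Suc m)"
      and col: "col W 0 = c \<cdot>\<^sub>v v" .
  define B where "B = W\<^sup>T * A * W"
  have B: "B \<in> carrier_mat (Suc m) (Suc m)" using W A by (simp add: B_def)
  have symB: "B\<^sup>T = B" unfolding B_def using transpose_conjugate_symmetric[OF A sym W] .
  have AW: "A *\<^sub>v col W 0 = e \<cdot>\<^sub>v col W 0"
    unfolding col using v A by (simp add: mult_mat_vec[of _ "Suc m" "Suc m"] smult_smult_assoc mult.commute)
  \<comment> \<open>Column 0 of \<open>W\<close> is an eigenvector, so column 0 of \<open>B\<close>
    is \<open>e\<close> times column 0 of \<open>W\<^sup>T * W\<close>.\<close>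
  have B0: "B $$ (i, 0) = (if i = 0 then e else 0)" if i: "i < Suc m" for i
  proof -
    have "B $$ (i, 0) = row W\<^sup>T i \<bullet> col (A * W) 0"
      unfolding B_def assoc_mult_mat[OF transpose_carrier_mat[THEN iffD2, OF W] A W] using i W A by simp
    also have "col (A * W) 0 = e \<cdot>\<^sub>v col W 0"
      using AW W A col_mult2[OF A W] by simp
    also have "row W\<^sup>T i \<bullet> (e \<cdot>\<^sub>v col W 0) = e * (W\<^sup>T * W) $$ (i, 0)"
      using i W by (simp add: scalar_prod_smult_distrib[of _ "Suc m"])
    finally show ?thesis unfolding WW using i by simp
  qed
  define C where "C = mat m m (\<lambda>(i, j). B $$ (Suc i, Suc j))"
  have sB: "B $$ (i, j) = B $$ (j, i)" if "i < Suc m" "j < Suc m" for i j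
    using symB B that by (metis carrier_matD index_transpose_mat(1))
  have C: "C \<in> carrier_mat m m" "C\<^sup>T = C"
    using sB by (auto simp: C_def)
  have BC: "B = four_block_mat (mat 1 1 (\<lambda>_. e)) (0\<^sub>m 1 m) (0\<^sub>m m 1) C" (is "_ = ?F")
  proof (rule eq_matI)
    fix i j assume "i < dim_row ?F" "j < dim_col ?F"
    then have ij: "i < Suc m" "j < Suc m" using C by auto
    then show "B $$ (i, j) = ?F $$ (i, j)"
      using B0[of i] B0[of j] sB[of 0 j] C by (cases i; cases j) (auto simp: C_def)
  qed (use B C in auto)
  obtain V where V: "V \<in> carrier_mat m m" "V\<^sup>T * V = 1\<^sub>m m" and dV: "diagonal_mat (V\<^sup>T * C * V)"
    using Suc.IH[OF C] by auto
  define V' where "V' = four_block_mat (1\<^sub>m 1) (0\<^sub>m 1 m) (0\<^sub>m m 1) V"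
  have V': "V' \<in> carrier_mat (Suc m) (Suc m)" using V by (auto simp: V'_def)
  have tV': "V'\<^sup>T = four_block_mat (1\<^sub>m 1) (0\<^sub>m 1 m) (0\<^sub>m m 1) V\<^sup>T"
    unfolding V'_def using V by (subst transpose_four_block_mat[of _ 1 1 _ m _ m]) auto
  have VV': "V'\<^sup>T * V' = 1\<^sub>m (Suc m)"
    unfolding tV' unfolding V'_def using V
    by (subst mult_four_block_mat[of _ 1 1 _ m _ m _ _ 1 _ m]) auto
  have D: "V'\<^sup>T * B * V' = four_block_mat (mat 1 1 (\<lambda>_. e)) (0\<^sub>m 1 m) (0\<^sub>m m 1) (V\<^sup>T * C * V)"
    unfolding tV' BC unfolding V'_def using V C
    by (subst mult_four_block_mat[of _ 1 1 _ m _ m _ _ 1 _ m], auto)+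
  define U where "U = W * V'"
  have U: "U \<in> carrier_mat (Suc m) (Suc m)" using W V' by (simp add: U_def)
  have tU: "U\<^sup>T = V'\<^sup>T * W\<^sup>T" unfolding U_def using W V' by (rule transpose_mult)
  have tr: "W\<^sup>T \<in> carrier_mat (Suc m) (Suc m)" "V'\<^sup>T \<in> carrier_mat (Suc m) (Suc m)" using W V' by auto
  note assoc = assoc_mult_mat[of _ "Suc m" "Suc m" _ "Suc m" _ "Suc m"]
  have "U\<^sup>T * U = V'\<^sup>T * ((W\<^sup>T * W) * V')"
    unfolding tU unfolding U_def using W V' tr by (simp add: assoc)
  then have "U\<^sup>T * U = 1\<^sub>m (Suc m)" using V' VV' by (simp add: WW)
  moreover have "U\<^sup>T * A * U = V'\<^sup>T * B * V'"
    unfolding tU unfolding U_def B_def using W V' A tr by (simp add: assoc)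
  then have "diagonal_mat (U\<^sup>T * A * U)"
    unfolding D using dV V C by (auto simp: diagonal_mat_def)
  ultimately show ?case using U by blast
qed

text \<open>\<open>u k\<close> is column k of the diagonalising matrix. The entrywise form allows
  vertices to replace indices later; the last two families of equations say that the rows and the
  columns of that matrix are orthonormal.\<close>

lemma symmetric_spectral_decomposition:
  fixes A :: "real mat"
  assumes A: "A \<in> carrier_mat n n" "A\<^sup>T = A"
  obtains es :: "real list" and u :: "nat \<Rightarrow> nat \<Rightarrow> real"
  where "length es = n" "mset es = eigenvalues A"
    "\<And>i j. i < n \<Longrightarrow> j < n \<Longrightarrow> A $$ (i, j) = (\<Sum>k<n. es ! k * u k i * u k j)"
    "\<And>i j. i < n \<Longrightarrow> j < n \<Longrightarrow> (\<Sum>k<n. u k i * u k j) = (if i = j then 1 else 0)"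
    "\<And>k l. k < n \<Longrightarrow> l < n \<Longrightarrow> (\<Sum>i<n. u k i * u l i) = (if k = l then 1 else 0)"
proof -
  obtain U where U: "U \<in> carrier_mat n n" and UU: "U\<^sup>T * U = 1\<^sub>m n"
    and diag: "diagonal_mat (U\<^sup>T * A * U)"
    using real_symmetric_diagonalisation[OF A] by blast
  have tU: "U\<^sup>T \<in> carrier_mat n n" using U by simp
  have UU': "U * U\<^sup>T = 1\<^sub>m n" by (rule mat_mult_left_right_inverse[OF tU U UU])
  define D where "D = U\<^sup>T * A * U"
  have D: "D \<in> carrier_mat n n" using U A by (simp add: D_def)
  note assoc = assoc_mult_mat[of _ n n _ n _ n]
  have "U * D * U\<^sup>T = (U * U\<^sup>T) * A * (U * U\<^sup>T)"
    unfolding D_def using U tU A by (simp add: assoc)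
  then have AD: "A = U * D * U\<^sup>T" using A by (simp add: UU')
  define es where "es = diag_mat D"
  have len: "length es = n" using D by (simp add: es_def diag_mat_def)
  have Dij: "D $$ (i, j) = (if i = j then es ! i else 0)" if "i < n" "j < n" for i j
    using diag D that unfolding D_def[symmetric] by (auto simp: diagonal_mat_def es_def diag_mat_def)
  have "similar_mat A D"
    unfolding similar_mat_def by (rule exI, rule exI, rule similar_mat_witI[OF UU' UU AD A(1) D U tU])
  then have "char_poly A = char_poly D" by (rule char_poly_similar)
  also have "\<dots> = (\<Prod>a \<leftarrow> es. [:- a, 1:])"
    unfolding es_def by (rule char_poly_upper_triangular[OF D]) (use Dij D in \<open>auto simp: upper_triangular_def\<close>)
  finally have "eigenvalues A = proots (\<Prod>a \<leftarrow> es. [:- a, 1:])" by (simp add: eigenvalues_def)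
  also have "\<dots> = mset es"
  proof (induction es)
    case (Cons a es)
    have "(\<Prod>a \<leftarrow> es. [:- a, 1:]) \<noteq> 0" by (auto simp: prod_list_zero_iff)
    then show ?case using Cons by (simp add: proots_mult del: mult_pCons_left)
  qed simp
  finally have ev: "mset es = eigenvalues A" ..
  define u where "u k i = U $$ (i, k)" for k i
  have UD: "(U * D) $$ (i, k) = es ! k * u k i" if "i < n" "k < n" for i k
  proof -
    have "(U * D) $$ (i, k) = (\<Sum>l = 0..<n. U $$ (i, l) * D $$ (l, k))"
      using that U D by (simp add: scalar_prod_def)
    also have "\<dots> = (\<Sum>l = 0..<n. if l = k then es ! k * U $$ (i, k) else 0)"
      by (intro sum.cong) (use that in \<open>auto simp: Dij\<close>)
    finally show ?thesis using that by (simp add: u_def)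
  qed
  have "A $$ (i, j) = (\<Sum>k<n. es ! k * u k i * u k j)" if ij: "i < n" "j < n" for i j
  proof -
    define X where "X = U * D"
    have X: "X \<in> carrier_mat n n" using U D by (simp add: X_def)
    have "A $$ (i, j) = row X i \<bullet> col U\<^sup>T j"
      unfolding AD X_def[symmetric] by (rule index_mult_mat(1)) (use ij U X in auto)
    also have "\<dots> = (\<Sum>k<n. X $$ (i, k) * u k j)"
      using ij U X by (auto simp: scalar_prod_def lessThan_atLeast0 u_def)
    finally show ?thesis using ij by (simp add: UD[folded X_def])
  qed
  moreover have "(\<Sum>k<n. u k i * u k j) = (if i = j then 1 else 0)" if ij: "i < n" "j < n" for i j
  proof -
    have "(\<Sum>k<n. u k i * u k j) = (U * U\<^sup>T) $$ (i, j)"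
      using ij U by (auto simp: scalar_prod_def lessThan_atLeast0 u_def)
    then show ?thesis unfolding UU' using ij by simp
  qed
  moreover have "(\<Sum>i<n. u k i * u l i) = (if k = l then 1 else 0)" if ij: "k < n" "l < n" for k l
  proof -
    have "(\<Sum>i<n. u k i * u l i) = (U\<^sup>T * U) $$ (k, l)"
      using ij U by (auto simp: scalar_prod_def lessThan_atLeast0 u_def)
    then show ?thesis unfolding UU using ij by simp
  qed
  ultimately show ?thesis using that len ev by blast
qed

section \<open>Products and moduli of non-zero eigenvalues\<close>

text \<open>Among the index sets with as many elements as there are non-zero entries, all but one
  contain the position of a zero, so a single summand survives.\<close>

lemma Upsilon_eq_prod_nonzero_eigenvalues:
  "Upsilon (size (filter_mset (\<lambda>x. x \<noteq> 0) (eigenvalues M))) M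
     = prod_mset (filter_mset (\<lambda>x. x \<noteq> 0) (eigenvalues M))"
proof -
  define xs where "xs = (SOME xs. mset xs = eigenvalues M)"
  have xs: "mset xs = eigenvalues M"
    unfolding xs_def by (rule someI_ex) (rule ex_mset)
  define N where "N = {i \<in> {..<length xs}. xs ! i \<noteq> 0}"
  have N: "finite N" "N \<subseteq> {..<length xs}" by (auto simp: N_def)
  have "mset xs = image_mset ((!) xs) (mset_set {..<length xs})"
    by (metis atLeast_upt map_nth mset_map mset_set_upto_eq_mset_upto)
  then have filter: "filter_mset (\<lambda>x. x \<noteq> 0) (eigenvalues M) = image_mset ((!) xs) (mset_set N)"
    unfolding xs[symmetric] by (simp add: filter_mset_image_mset N_def)
  have zero: "(\<Prod>i\<in>I. xs ! i) = 0" if I: "I \<subseteq> {..<length xs}" "card I = card N" "I \<noteq> N" for I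
  proof -
    have "finite I" using I by (meson finite_lessThan finite_subset)
    moreover have "\<not> I \<subseteq> N" using card_subset_eq[OF N(1)] I by blast
    ultimately show ?thesis using I(1) by (auto simp: N_def)
  qed
  have "Upsilon (card N) M = (\<Sum>I | I \<subseteq> {..<length xs} \<and> card I = card N. \<Prod>i\<in>I. xs ! i)"
    by (simp add: Upsilon_def Let_def xs_def)
  also have "\<dots> = (\<Sum>I | I \<subseteq> {..<length xs} \<and> card I = card N. if I = N then \<Prod>i\<in>N. xs ! i else 0)"
    by (intro sum.cong) (auto simp: zero)
  also have "\<dots> = (\<Prod>i\<in>N. xs ! i)"
    by (subst sum.delta) (use N in auto)
  finally show ?thesis by (simp add: filter prod_unfold_prod_mset)
qed

text \<open>The deficits t - 1 - ln t are non-negative and vanish only at t = 1. Bound and equality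
  case go through one induction, because a vanishing total forces both deficits to vanish only when
  neither can be negative.\<close>

lemma size_plus_ln_prod_mset_le:
  fixes S :: "real multiset"
  assumes "\<forall>\<mu>\<in>#S. \<mu> \<noteq> 0"
  shows "size S + ln \<bar>prod_mset S\<bar> \<le> (\<Sum>\<mu>\<in>#S. \<bar>\<mu>\<bar>) \<and>
    (size S + ln \<bar>prod_mset S\<bar> = (\<Sum>\<mu>\<in>#S. \<bar>\<mu>\<bar>) \<longleftrightarrow> (\<forall>\<mu>\<in>#S. \<bar>\<mu>\<bar> = 1))"
  using assms
proof (induction S)
  case (add x S)
  have "prod_mset S \<noteq> 0" using add.prems by auto
  then have ln: "ln \<bar>prod_mset (add_mset x S)\<bar> = ln \<bar>x\<bar> + ln \<bar>prod_mset S\<bar>"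
    using add.prems by (simp add: abs_mult ln_mult)
  have "ln \<bar>x\<bar> \<le> \<bar>x\<bar> - 1" "ln \<bar>x\<bar> = \<bar>x\<bar> - 1 \<longleftrightarrow> \<bar>x\<bar> = 1"
    using add.prems ln_le_minus_one[of "\<bar>x\<bar>"] ln_eq_minus_one[of "\<bar>x\<bar>"] by auto
  then show ?case using add unfolding ln by auto
qed simp

section \<open>Isomorphisms onto unions of complete graphs\<close>

lemma complete_graph_edge_iff [simp]:
  "{x, y} \<in> edges (complete_graph s) \<longleftrightarrow> x \<noteq> y \<and> x < s \<and> y < s"
  by (auto simp: complete_graph_def card_insert_if)

lemma verts_complete_graph [simp]: "verts (complete_graph s) = {..<s}"
  by (simp add: complete_graph_def)

lemma verts_copies [simp]: "verts (t \<cdot>\<^sub>g H) = {..<t} \<times> verts H"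
  by (simp add: copies_def)

lemma copies_edge_iff [simp]:
  "{(i, x), (j, y)} \<in> edges (t \<cdot>\<^sub>g H) \<longleftrightarrow> i = j \<and> i < t \<and> {x, y} \<in> edges H"
proof
  assume "{(i, x), (j, y)} \<in> edges (t \<cdot>\<^sub>g H)"
  then obtain k e where k: "k < t" "e \<in> edges H" and eq: "{(i, x), (j, y)} = Pair k ` e"
    by (auto simp: copies_def)
  have "i = k" "j = k" using eq by blast+
  moreover have "{x, y} = snd ` {(i, x), (j, y)}" by auto
  then have "{x, y} = e" unfolding eq by (simp add: image_image)
  ultimately show "i = j \<and> i < t \<and> {x, y} \<in> edges H" using k by auto
next
  assume "i = j \<and> i < t \<and> {x, y} \<in> edges H"
  then show "{(i, x), (j, y)} \<in> edges (t \<cdot>\<^sub>g H)"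
    unfolding copies_def by (auto intro!: bexI[of _ j] image_eqI[of _ _ "{x, y}"])
qed

lemma verts_disjoint_union [simp]: "verts (G \<uplus>\<^sub>g H) = verts G <+> verts H"
  by (simp add: disjoint_union_def)

lemma disjoint_union_edge_iff [simp]:
  "{Inl x, Inl y} \<in> edges (G \<uplus>\<^sub>g H) \<longleftrightarrow> {x, y} \<in> edges G"
  "{Inr z, Inr w} \<in> edges (G \<uplus>\<^sub>g H) \<longleftrightarrow> {z, w} \<in> edges H"
  "{Inl x, Inr z} \<notin> edges (G \<uplus>\<^sub>g H)"
  "{Inr z, Inl x} \<notin> edges (G \<uplus>\<^sub>g H)"
proof -
  have l: "{Inl x, Inl y} = Inl ` {x, y}" for x y by simp
  have r: "{Inr x, Inr y} = Inr ` {x, y}" for x y by simp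
  have "inj (Inl :: _ \<Rightarrow> 'a + 'b)" "inj (Inr :: _ \<Rightarrow> 'a + 'b)" by auto
  then show "{Inl x, Inl y} \<in> edges (G \<uplus>\<^sub>g H) \<longleftrightarrow> {x, y} \<in> edges G"
    "{Inr z, Inr w} \<in> edges (G \<uplus>\<^sub>g H) \<longleftrightarrow> {z, w} \<in> edges H"
    unfolding disjoint_union_def l r by (auto simp: inj_image_eq_iff simp del: image_insert)
  show "{Inl x, Inr z} \<notin> edges (G \<uplus>\<^sub>g H)" "{Inr z, Inl x} \<notin> edges (G \<uplus>\<^sub>g H)"
    unfolding disjoint_union_def by auto
qed

text \<open>Replacing only \<open>verts\<close> keeps all edges of \<open>G\<close>, even those that
  leave the new vertex set. The result still stands for the induced subgraph, since
  \<open>graph_iso\<close> tests only pairs of vertices.\<close>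

lemma graph_iso_disjoint_unionI:
  assumes A: "G\<lparr>verts := A\<rparr> \<simeq>\<^sub>g H" and B: "G\<lparr>verts := B\<rparr> \<simeq>\<^sub>g K"
    and V: "A \<inter> B = {}" "verts G = A \<union> B"
    and sep: "\<And>a b. a \<in> A \<Longrightarrow> b \<in> B \<Longrightarrow> {a, b} \<notin> edges G"
  shows "G \<simeq>\<^sub>g H \<uplus>\<^sub>g K"
proof -
  obtain f where f: "bij_betw f A (verts H)"
    "\<And>u v. u \<in> A \<Longrightarrow> v \<in> A \<Longrightarrow> {u, v} \<in> edges G \<longleftrightarrow> {f u, f v} \<in> edges H"
    using A by (auto simp: graph_iso_def)
  obtain g where g: "bij_betw g B (verts K)"
    "\<And>u v. u \<in> B \<Longrightarrow> v \<in> B \<Longrightarrow> {u, v} \<in> edges G \<longleftrightarrow> {g u, g v} \<in> edges K"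
    using B by (auto simp: graph_iso_def)
  define h where "h v = (if v \<in> A then Inl (f v) else Inr (g v))" for v
  have hA: "h v = Inl (f v)" if "v \<in> A" for v using that by (simp add: h_def)
  have hB: "h v = Inr (g v)" if "v \<in> B" for v using that V by (auto simp: h_def)
  have "bij_betw h A (Inl ` verts H)"
    using bij_betw_trans[OF f(1) inj_on_imp_bij_betw[of Inl "verts H"]] bij_betw_cong[of A h "Inl \<circ> f"] hA by auto
  moreover have "bij_betw h B (Inr ` verts K)"
    using bij_betw_trans[OF g(1) inj_on_imp_bij_betw[of Inr "verts K"]] bij_betw_cong[of B h "Inr \<circ> g"] hB by auto
  ultimately have "bij_betw h (verts G) (verts (H \<uplus>\<^sub>g K))"
    unfolding V(2) verts_disjoint_union Plus_def by (rule bij_betw_combine) auto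
  moreover have "{u, v} \<in> edges G \<longleftrightarrow> {h u, h v} \<in> edges (H \<uplus>\<^sub>g K)"
    if "u \<in> verts G" "v \<in> verts G" for u v
    using that sep[of u v] sep[of v u] unfolding V(2) by (auto simp: hA hB f g insert_commute)
  ultimately show ?thesis unfolding graph_iso_def by blast
qed

lemma graph_iso_complete_graph:
  assumes "finite (verts G)"
    and "\<And>v w. v \<in> verts G \<Longrightarrow> w \<in> verts G \<Longrightarrow> {v, w} \<in> edges G \<longleftrightarrow> v \<noteq> w"
  shows "G \<simeq>\<^sub>g complete_graph (card (verts G))"
proof -
  obtain f where f: "bij_betw f (verts G) {0..<card (verts G)}"
    using ex_bij_betw_finite_nat[OF assms(1)] by blast
  have "f v < card (verts G)" "f v = f w \<longleftrightarrow> v = w" if "v \<in> verts G" "w \<in> verts G" for v w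
    using f that by (auto simp: bij_betw_def inj_on_def)
  then show ?thesis
    unfolding graph_iso_def using f assms(2) by (intro exI[of _ f]) (auto simp: lessThan_atLeast0)
qed

lemma graph_iso_copies_complete_graph:
  assumes fin: "finite (verts G)" and R: "equiv (verts G) R"
    and E: "\<And>v w. v \<in> verts G \<Longrightarrow> w \<in> verts G \<Longrightarrow> {v, w} \<in> edges G \<longleftrightarrow> v \<noteq> w \<and> (v, w) \<in> R"
    and card: "\<And>v. v \<in> verts G \<Longrightarrow> card (R `` {v}) = r"
  shows "\<exists>t. card (verts G) = t * r \<and> G \<simeq>\<^sub>g t \<cdot>\<^sub>g complete_graph r"
proof -
  let ?V = "verts G" and ?Q = "verts G // R"
  define t where "t = card ?Q"
  have finQ: "finite ?Q" using fin R by (simp add: finite_quotient equiv_type)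
  have cardC: "card C = r" if "C \<in> ?Q" for C
    using that card by (auto elim!: quotientE)
  have finC: "finite C" if "C \<in> ?Q" for C
    using that fin R by (meson finite_equiv_class equiv_type)
  have "?V = \<Union>?Q" using Union_quotient[OF R] by simp
  moreover have "card (\<Union>?Q) = (\<Sum>C\<in>?Q. card C)"
    by (rule card_Union_disjoint) (use quotient_disj[OF R] finC in \<open>auto simp: pairwise_def disjnt_def\<close>)
  ultimately have "card ?V = t * r"
    by (simp add: cardC t_def)
  moreover obtain g where g: "bij_betw g ?Q {0..<t}"
    using ex_bij_betw_finite_nat[OF finQ] t_def by blast
  have "\<forall>C\<in>?Q. \<exists>h. bij_betw h C {0..<r}"
    using ex_bij_betw_finite_nat[OF finC] cardC by metis
  then obtain h where h: "\<And>C. C \<in> ?Q \<Longrightarrow> bij_betw (h C) C {0..<r}"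
    by metis
  \<comment> \<open>A vertex goes to the number of its class and its position inside that
    class.\<close>
  define f where "f v = (g (R `` {v}), h (R `` {v}) v)" for v
  have cls: "R `` {v} \<in> ?Q" "v \<in> R `` {v}" if "v \<in> ?V" for v
    using that by (rule quotientI, rule equiv_class_self[OF R])
  have g_eq: "g (R `` {v}) = g (R `` {w}) \<longleftrightarrow> (v, w) \<in> R" if "v \<in> ?V" "w \<in> ?V" for v w
    using that cls g eq_equiv_class_iff[OF R] by (metis bij_betw_def inj_on_eq_iff)
  have h_lt: "h (R `` {v}) v < r" if "v \<in> ?V" for v
    using bij_betwE[OF h[OF cls(1)[OF that]]] cls(2)[OF that] by auto
  have g_lt: "g (R `` {v}) < t" if "v \<in> ?V" for v
    using bij_betwE[OF g] cls(1)[OF that] by auto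
  have f_eq: "v = w" if vw: "v \<in> ?V" "w \<in> ?V" and eq: "f v = f w" for v w
  proof -
    have "(v, w) \<in> R" using eq g_eq[OF vw] by (simp add: f_def)
    then have "R `` {v} = R `` {w}" using equiv_class_eq[OF R] by simp
    then show ?thesis
      using eq h[OF cls(1)[OF vw(1)]] cls vw unfolding f_def bij_betw_def inj_on_def by (metis Pair_inject)
  qed
  have "bij_betw f ?V (verts (t \<cdot>\<^sub>g complete_graph r))"
    unfolding bij_betw_def
  proof (intro conjI inj_onI equalityI subsetI)
    fix y assume "y \<in> verts (t \<cdot>\<^sub>g complete_graph r)"
    then obtain i j where y: "y = (i, j)" "i < t" "j < r" by auto
    then obtain C where C: "C \<in> ?Q" "g C = i"
      using g by (metis atLeast0LessThan bij_betw_iff_bijections lessThan_iff)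
    then obtain v where v: "v \<in> C" "h C v = j"
      using h y by (metis atLeast0LessThan bij_betw_iff_bijections lessThan_iff)
    have "v \<in> ?V" "R `` {v} = C"
      using v C R by (auto dest: in_quotient_imp_subset[OF R] quotient_eq_iff[OF R]
          simp: Image_singleton elim!: quotientE intro: equivE)
        (metis Image_singleton_iff R equiv_class_eq_iff)+
    then show "y \<in> f ` ?V" using y C v by (auto simp: f_def)
  qed (use f_eq in \<open>auto simp: f_def g_lt h_lt\<close>)
  moreover have "{v, w} \<in> edges G \<longleftrightarrow> {f v, f w} \<in> edges (t \<cdot>\<^sub>g complete_graph r)"
    if vw: "v \<in> ?V" "w \<in> ?V" for v w
  proof -
    have "(v, w) \<in> R \<Longrightarrow> h (R `` {v}) v = h (R `` {w}) w \<longleftrightarrow> v = w"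
      using f_eq[OF vw] g_eq[OF vw] equiv_class_eq[OF R, of v w] by (auto simp: f_def)
    then show ?thesis using E vw g_lt h_lt g_eq by (auto simp: f_def)
  qed
  ultimately show ?thesis unfolding graph_iso_def by blast
qed

section \<open>Functional calculus of the adjacency matrix\<close>

text \<open>An orthonormal eigenbasis indexed by vertices, which hides the enumeration behind
  \<open>adj_matrix\<close>.\<close>

locale graph_spectrum =
  fixes G :: "'a graph" and es :: "real list" and u :: "nat \<Rightarrow> 'a \<Rightarrow> real"
  assumes simple: "simple_graph G"
    and spectrum: "mset es = graph_eigenvalues G"
    and adjacency: "v \<in> verts G \<Longrightarrow> w \<in> verts G \<Longrightarrow>
      (\<Sum>k<length es. es ! k * u k v * u k w) = of_bool ({v, w} \<in> edges G)"
    and completeness: "v \<in> verts G \<Longrightarrow> w \<in> verts G \<Longrightarrow>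
      (\<Sum>k<length es. u k v * u k w) = of_bool (v = w)"
    and orthonormality: "k < length es \<Longrightarrow> l < length es \<Longrightarrow>
      (\<Sum>v\<in>verts G. u k v * u l v) = of_bool (k = l)"

lemma graph_spectrum_exists:
  assumes simple: "simple_graph G"
  obtains es u where "graph_spectrum G es u"
proof -
  let ?V = "verts G"
  define n where "n = card ?V"
  define xs where "xs = vertex_list G"
  have "finite ?V" using simple by (simp add: simple_graph_def)
  from finite_distinct_list[OF this] obtain ys where "set ys = ?V \<and> distinct ys" ..
  then have "set xs = ?V \<and> distinct xs"
    unfolding xs_def vertex_list_def
    by (rule someI[of "\<lambda>xs. set xs = ?V \<and> distinct xs"])
  then have xs: "set xs = ?V" "distinct xs" by auto
  have len: "length xs = n" using xs distinct_card n_def by metis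
  have bij: "bij_betw ((!) xs) {..<n} ?V"
    using bij_betw_nth[OF xs(2), of "{..<n}" ?V] xs len by auto
  define A where "A = adj_matrix G"
  have A: "A \<in> carrier_mat n n" by (simp add: A_def adj_matrix_def Let_def n_def)
  have Aij: "A $$ (i, j) = of_bool ({xs ! i, xs ! j} \<in> edges G)" if "i < n" "j < n" for i j
    using that by (simp add: A_def adj_matrix_def Let_def n_def xs_def)
  have sym: "A\<^sup>T = A" using A by (intro eq_matI) (auto simp: Aij insert_commute)
  obtain es u where es: "length es = n" "mset es = eigenvalues A"
    and u: "\<And>i j. i < n \<Longrightarrow> j < n \<Longrightarrow> A $$ (i, j) = (\<Sum>k<n. es ! k * u k i * u k j)"
      "\<And>i j. i < n \<Longrightarrow> j < n \<Longrightarrow> (\<Sum>k<n. u k i * u k j) = (if i = j then 1 else 0)"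
      "\<And>k l. k < n \<Longrightarrow> l < n \<Longrightarrow> (\<Sum>i<n. u k i * u l i) = (if k = l then 1 else 0)"
    using symmetric_spectral_decomposition[OF A sym] by blast
  \<comment> \<open>The position of a vertex in the enumeration; the eigenvectors are pulled back
    along it.\<close>
  define p where "p = inv_into {..<n} ((!) xs)"
  have p: "p v < n" "xs ! p v = v" if "v \<in> ?V" for v
    using that bij inv_into_into[of v "(!) xs" "{..<n}"] f_inv_into_f[of v "(!) xs" "{..<n}"]
    unfolding p_def bij_betw_def by auto
  have p_nth: "p (xs ! i) = i" if "i < n" for i
    unfolding p_def using that bij by (simp add: bij_betw_inv_into_left)
  have p_eq: "p v = p w \<longleftrightarrow> v = w" if "v \<in> ?V" "w \<in> ?V" for v w
    using p that by metis
  have "graph_spectrum G es (\<lambda>k v. u k (p v))"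
  proof
    show "simple_graph G" by fact
    show "mset es = graph_eigenvalues G" using es by (simp add: graph_eigenvalues_def A_def)
    fix v w assume vw: "v \<in> ?V" "w \<in> ?V"
    show "(\<Sum>k<length es. es ! k * u k (p v) * u k (p w)) = of_bool ({v, w} \<in> edges G)"
      using u(1)[of "p v" "p w"] Aij[of "p v" "p w"] p vw es by simp
    show "(\<Sum>k<length es. u k (p v) * u k (p w)) = of_bool (v = w)"
      using u(2)[of "p v" "p w"] p vw es p_eq by simp
  next
    fix k l assume kl: "k < length es" "l < length es"
    have "(\<Sum>v\<in>?V. u k (p v) * u l (p v)) = (\<Sum>i<n. u k i * u l i)"
      by (subst sum.reindex_bij_betw[OF bij, symmetric]) (simp add: p_nth)
    then show "(\<Sum>v\<in>?V. u k (p v) * u l (p v)) = of_bool (k = l)"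
      using u(3) kl es by simp
  qed
  then show ?thesis by (rule that)
qed

context graph_spectrum
begin

text \<open>The matrix \<open>f(A)\<close> of the functional calculus of the adjacency matrix \<open>A\<close>.\<close>

definition calc :: "(real \<Rightarrow> real) \<Rightarrow> 'a \<Rightarrow> 'a \<Rightarrow> real" where
  "calc f v w = (\<Sum>k<length es. f (es ! k) * u k v * u k w)"

lemma finite_verts: "finite (verts G)"
  using simple by (simp add: simple_graph_def)

lemma no_loops: "{v, v} \<notin> edges G"
  using simple by (auto simp: simple_graph_def)

text \<open>Orthonormality of the eigenvectors removes the cross terms: this is f(A) g(A) = (f
  g)(A).\<close>

lemma calc_mult:
  "(\<Sum>x\<in>verts G. calc f v x * calc g x w) = calc (\<lambda>e. f e * g e) v w"
proof -
  let ?I = "{..<length es}"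
  let ?F = "\<lambda>k. f (es ! k) * u k v" and ?G = "\<lambda>l. g (es ! l) * u l w"
  have "(\<Sum>x\<in>verts G. calc f v x * calc g x w)
      = (\<Sum>x\<in>verts G. \<Sum>k\<in>?I. \<Sum>l\<in>?I. ?F k * ?G l * (u k x * u l x))"
    unfolding calc_def sum_product by (intro sum.cong) (auto simp: mult_ac)
  also have "\<dots> = (\<Sum>k\<in>?I. \<Sum>l\<in>?I. \<Sum>x\<in>verts G. ?F k * ?G l * (u k x * u l x))"
    by (subst sum.swap, rule sum.cong[OF refl], rule sum.swap)
  also have "\<dots> = (\<Sum>k\<in>?I. \<Sum>l\<in>?I. if l = k then ?F k * ?G k else 0)"
    by (intro sum.cong refl) (auto simp: orthonormality simp flip: sum_distrib_left)
  also have "\<dots> = calc (\<lambda>e. f e * g e) v w"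
    unfolding calc_def by (auto intro!: sum.cong)
  finally show ?thesis .
qed

text \<open>The eigenvectors have unit length. This is the bridge from sums over the spectrum to
  sums over vertices.\<close>

lemma calc_trace: "(\<Sum>v\<in>verts G. calc f v v) = (\<Sum>\<mu>\<in>#graph_eigenvalues G. f \<mu>)"
proof -
  have "(\<Sum>v\<in>verts G. calc f v v) = (\<Sum>k<length es. \<Sum>v\<in>verts G. f (es ! k) * (u k v * u k v))"
    unfolding calc_def by (subst sum.swap) (simp add: mult_ac)
  also have "\<dots> = (\<Sum>k<length es. f (es ! k))"
    by (intro sum.cong refl) (simp add: orthonormality flip: sum_distrib_left)
  also have "\<dots> = (\<Sum>\<mu>\<in>#mset es. f \<mu>)"
    by (simp add: sum_list_sum_nth lessThan_atLeast0 sum_mset_sum_list flip: mset_map)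
  finally show ?thesis by (simp add: spectrum)
qed

lemma calc_add: "calc (\<lambda>e. f e + g e) v w = calc f v w + calc g v w"
  by (simp add: calc_def sum.distrib algebra_simps)

lemma calc_cmult: "calc (\<lambda>e. c * f e) v w = c * calc f v w"
  by (simp add: calc_def sum_distrib_left mult_ac)

text \<open>The reflexive closure of adjacency: its 0/1 matrix is A + I, and unlike adjacency it can
  be an equivalence relation.\<close>

definition near :: "'a \<Rightarrow> 'a \<Rightarrow> bool" where
  "near v w \<longleftrightarrow> v = w \<or> {v, w} \<in> edges G"

lemma near_sym: "near v w \<longleftrightarrow> near w v"
  by (auto simp: near_def insert_commute)

lemma edge_iff_near: "{v, w} \<in> edges G \<longleftrightarrow> v \<noteq> w \<and> near v w"
  using no_loops by (auto simp: near_def)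

lemma calc_near:
  assumes "v \<in> verts G" "w \<in> verts G"
  shows "calc (\<lambda>e. e + 1) v w = of_bool (near v w)"
  using assms no_loops
  by (auto simp: calc_def distrib_right sum.distrib adjacency completeness near_def)

end

section \<open>Clique structure of graphs without eigenvalues below -1\<close>

locale graph_spectrum_ge_minus_one = graph_spectrum +
  assumes ge_minus_one: "\<mu> \<in># graph_eigenvalues G \<Longrightarrow> \<mu> \<ge> - 1"
begin

text \<open>An induced path \<open>a, b, c\<close> would make \<open>A + I\<close> negative on the vector \<open>1\<^sub>a - 1\<^sub>b + 1\<^sub>c\<close>.\<close>

lemma near_trans:
  assumes V: "a \<in> verts G" "b \<in> verts G" "c \<in> verts G" and ab: "near a b" and bc: "near b c"
  shows "near a c"
proof (rule ccontr)
  assume ac: "\<not> near a c"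
  let ?J = "calc (\<lambda>e. e + 1)"
  have "es ! k + 1 \<ge> 0" if "k < length es" for k
    using ge_minus_one[of "es ! k"] that nth_mem_mset[of k es] spectrum by simp
  then have "0 \<le> (\<Sum>k<length es. (es ! k + 1) * (u k a - u k b + u k c)\<^sup>2)"
    by (intro sum_nonneg) simp
  also have "\<dots> = ?J a a + ?J b b + ?J c c - 2 * ?J a b - 2 * ?J b c + 2 * ?J a c"
    unfolding calc_def sum_distrib_left
    by (simp add: power2_eq_square algebra_simps sum.distrib sum_subtractf)
  \<comment> \<open>Three diagonal ones, two near pairs and one pair that is not near: 3 - 2 - 2 +
    0.\<close>
  also have "\<dots> = - 1"
    using V ab bc ac by (simp add: calc_near) (simp add: near_def)
  finally show False by simp
qed

lemma near_cong:
  assumes "v \<in> verts G" "x \<in> verts G" "w \<in> verts G" "near v x"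
  shows "near x w \<longleftrightarrow> near v w"
  using near_trans[of v x w] near_trans[of x v w] near_sym[of v x] assms by blast

text \<open>By \<open>near_trans\<close> this is a class of an equivalence relation, namely the
  connected component of \<open>v\<close>. It contains \<open>v\<close>, so an isolated vertex has a
  clique of size 1.\<close>

definition clique :: "'a \<Rightarrow> 'a set" where
  "clique v = {w \<in> verts G. near v w}"

lemma clique_eq:
  assumes "v \<in> verts G" "w \<in> verts G" "near v w"
  shows "clique v = clique w"
  using near_cong[OF assms(1,2) _ assms(3)] by (auto simp: clique_def)

lemma clique_self: "v \<in> verts G \<Longrightarrow> v \<in> clique v"
  by (simp add: clique_def near_def)

lemma finite_clique: "finite (clique v)"
  using finite_verts by (simp add: clique_def)

lemma card_clique_pos: "v \<in> verts G \<Longrightarrow> card (clique v) \<ge> 1"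
  using clique_self finite_clique by (metis card_gt_0_iff empty_iff less_eq_Suc_le One_nat_def)

text \<open>The entry counts the vertices near both v and w: by transitivity that is the whole
  clique or nothing. In blocks, J^2 = m J.\<close>

lemma calc_near_square:
  assumes V: "v \<in> verts G" "w \<in> verts G"
  shows "calc (\<lambda>e. (e + 1) * (e + 1)) v w = card (clique v) * of_bool (near v w)"
proof -
  have "calc (\<lambda>e. (e + 1) * (e + 1)) v w = (\<Sum>x\<in>verts G. of_bool (near v x) * of_bool (near x w))"
    unfolding calc_mult[symmetric] by (intro sum.cong) (auto simp: calc_near V)
  also have "\<dots> = (\<Sum>x\<in>verts G. if near v x then of_bool (near v w) else 0)"
    by (intro sum.cong refl) (auto simp: near_cong[OF V(1) _ V(2)])
  also have "\<dots> = card (clique v) * of_bool (near v w)"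
    using finite_verts by (simp add: sum.If_cases clique_def Int_def)
  finally show ?thesis .
qed

lemma calc_near_cube:
  assumes V: "v \<in> verts G" "w \<in> verts G"
  shows "calc (\<lambda>e. (e + 1) * ((e + 1) * (e + 1))) v w = (card (clique v))\<^sup>2 * of_bool (near v w)"
proof -
  have "calc (\<lambda>e. (e + 1) * ((e + 1) * (e + 1))) v w
      = (\<Sum>x\<in>verts G. of_bool (near v x) * (real (card (clique x)) * of_bool (near x w)))"
    unfolding calc_mult[symmetric, of "\<lambda>e. e + 1" "\<lambda>e. (e + 1) * (e + 1)"]
    by (intro sum.cong refl) (auto simp: calc_near calc_near_square V)
  also have "\<dots> = (\<Sum>x\<in>verts G. if near v x then real (card (clique v)) * of_bool (near v w) else 0)"
    by (intro sum.cong refl) (auto simp: near_cong[OF V(1) _ V(2)] clique_eq[OF V(1)])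
  also have "\<dots> = (card (clique v))\<^sup>2 * of_bool (near v w)"
    using finite_verts by (simp add: sum.If_cases clique_def Int_def power2_eq_square)
  finally show ?thesis .
qed

text \<open>With t = e + 1 the polynomial is t(t-1)(t-2) = t^3 - 3t^2 + 2t, and t^k contributes
  m^(k-1) on a clique of size m. On the diagonal, (m-1)(m-2) is twice the number of triangles at
  v.\<close>

lemma calc_triangles:
  assumes V: "v \<in> verts G" "w \<in> verts G"
  shows "calc (\<lambda>e. (e + 1) * e * (e - 1)) v w
    = (real (card (clique v)) - 1) * (real (card (clique v)) - 2) * of_bool (near v w)"
proof -
  have "calc (\<lambda>e. (e + 1) * e * (e - 1)) v w = calc (\<lambda>e. (e + 1) * ((e + 1) * (e + 1))) v w
      + ((- 3) * calc (\<lambda>e. (e + 1) * (e + 1)) v w + 2 * calc (\<lambda>e. e + 1) v w)"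
    unfolding calc_add[symmetric] calc_cmult[symmetric]
    by (intro arg_cong[of _ _ "\<lambda>f. calc f v w"] ext) (simp add: algebra_simps)
  then show ?thesis
    unfolding calc_near[OF V] calc_near_square[OF V] calc_near_cube[OF V]
    by (simp add: power2_eq_square algebra_simps)
qed

text \<open>1 - e^2 = 2(e+1) - (e+1)^2. Equivalently, the diagonal of A^2 holds the degrees, which
  are the clique sizes minus 1.\<close>

lemma sum_one_minus_square:
  "(\<Sum>\<mu>\<in>#graph_eigenvalues G. 1 - \<mu>\<^sup>2) = (\<Sum>v\<in>verts G. 2 - real (card (clique v)))"
proof -
  have "calc (\<lambda>e. 1 - e\<^sup>2) v v = 2 - real (card (clique v))" if V: "v \<in> verts G" for v
  proof -
    have "calc (\<lambda>e. 1 - e\<^sup>2) v v = 2 * calc (\<lambda>e. e + 1) v v + (- 1) * calc (\<lambda>e. (e + 1) * (e + 1)) v v"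
      unfolding calc_add[symmetric] calc_cmult[symmetric]
      by (intro arg_cong[of _ _ "\<lambda>f. calc f v v"] ext) (simp add: power2_eq_square algebra_simps)
    then show ?thesis
      unfolding calc_near[OF V V] calc_near_square[OF V V] by (simp add: near_def)
  qed
  then show ?thesis unfolding calc_trace[symmetric] by simp
qed

lemma sum_triangles:
  "(\<Sum>\<mu>\<in>#graph_eigenvalues G. (\<mu> + 1) * \<mu> * (\<mu> - 1))
     = (\<Sum>v\<in>verts G. (real (card (clique v)) - 1) * (real (card (clique v)) - 2))"
  unfolding calc_trace[symmetric] by (simp add: calc_triangles near_def)

end

text \<open>Near vertices share their clique, so \<open>A\<close> is a union of whole cliques and
  \<open>near\<close> restricts to it with all classes of size \<open>r\<close>.\<close>

lemma (in graph_spectrum_ge_minus_one) same_size_cliques_iso: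
  assumes "A = {v \<in> verts G. card (clique v) = r}"
  shows "\<exists>t. card A = t * r \<and> G\<lparr>verts := A\<rparr> \<simeq>\<^sub>g t \<cdot>\<^sub>g complete_graph r"
proof -
  define R where "R = {(v, w). v \<in> A \<and> w \<in> A \<and> near v w}"
  have A: "A \<subseteq> verts G" using assms by auto
  have "equiv A R"
  proof (rule equivI)
    show "refl_on A R" by (auto simp: R_def refl_on_def near_def)
    show "sym R" by (auto simp: R_def sym_def near_sym)
    show "trans R" unfolding R_def trans_def using near_trans A by blast
  qed (auto simp: R_def)
  moreover have "R `` {v} = clique v" if "v \<in> A" for v
    using that clique_eq[of v] assms by (auto simp: R_def clique_def)
  ultimately show ?thesis
    using graph_iso_copies_complete_graph[of "G\<lparr>verts := A\<rparr>" R r] A finite_verts assms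
    by (auto simp: R_def edge_iff_near intro: finite_subset)
qed

section \<open>The case of equality\<close>

text \<open>\<open>S\<close> retains the zero eigenvalues, so \<open>rest\<close> constrains
  everything except one copy of \<open>lam1\<close>.\<close>

locale graph_spectrum_equality = graph_spectrum +
  fixes lam1 :: real and S :: "real multiset"
  assumes eigenvalues: "graph_eigenvalues G = add_mset lam1 S"
    and rest: "\<mu> \<in># S \<Longrightarrow> \<mu> \<in> {-1, 0, 1}"
    and lam1_ge: "lam1 \<ge> 1"

sublocale graph_spectrum_equality \<subseteq> graph_spectrum_ge_minus_one
  by unfold_locales (use eigenvalues rest lam1_ge in fastforce)

context graph_spectrum_equality
begin

lemma sum_triangles_eq:
  "(\<Sum>v\<in>verts G. (real (card (clique v)) - 1) * (real (card (clique v)) - 2))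
     = (lam1 + 1) * lam1 * (lam1 - 1)"
proof -
  have "(\<Sum>\<mu>\<in>#S. (\<mu> + 1) * \<mu> * (\<mu> - 1)) = 0"
    using rest by (intro sum_mset.neutral) fastforce
  then show ?thesis unfolding sum_triangles[symmetric] by (simp add: eigenvalues)
qed

lemma sum_one_minus_square_eq:
  "(\<Sum>v\<in>verts G. 2 - real (card (clique v))) = 1 - lam1\<^sup>2 + count S 0"
proof -
  have "\<forall>\<mu>\<in>#S. \<mu> \<in> {-1, 0, 1} \<Longrightarrow> (\<Sum>\<mu>\<in>#S. 1 - \<mu>\<^sup>2) = real (count S 0)"
    by (induction S) auto
  then show ?thesis unfolding sum_one_minus_square[symmetric] using rest by (simp add: eigenvalues)
qed

text \<open>All eigenvalues but \<open>lam1\<close> are roots of \<open>x\<^sup>3 - x\<close>, so \<open>A\<^sup>3 - A\<close> has rank at most one. It is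
  block diagonal along the cliques and non-zero exactly on those with at least three vertices.\<close>

lemma large_cliques_near:
  assumes V: "v \<in> verts G" "w \<in> verts G" and card: "card (clique v) \<ge> 3" "card (clique w) \<ge> 3"
  shows "near v w"
proof -
  let ?f = "\<lambda>e::real. (e + 1) * e * (e - 1)"
  have "lam1 \<in># mset es" by (simp add: spectrum eigenvalues)
  then obtain k where k: "k < length es" "es ! k = lam1" by (auto simp: in_set_conv_nth)
  \<comment> \<open>Only position \<open>k\<close> is removed: a further copy of \<open>lam1\<close>
    elsewhere in the list lies in \<open>S\<close> and is subject to \<open>rest\<close>.\<close>
  have S: "S = image_mset ((!) es) (mset_set ({..<length es} - {k}))"
  proof -
    have "mset es = image_mset ((!) es) (mset_set {..<length es})"
      by (metis atLeast_upt map_nth mset_map mset_set_upto_eq_mset_upto)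
    also have "mset_set {..<length es} = add_mset k (mset_set ({..<length es} - {k}))"
      using k by (simp add: mset_set.remove)
    finally show ?thesis using k by (simp add: spectrum eigenvalues)
  qed
  have f0: "?f (es ! l) = 0" if "l < length es" "l \<noteq> k" for l
    using rest[of "es ! l"] that unfolding S by auto
  have calc: "calc ?f x y = ?f lam1 * u k x * u k y" for x y
  proof -
    have "calc ?f x y = (\<Sum>l<length es. if l = k then ?f lam1 * u k x * u k y else 0)"
      unfolding calc_def by (intro sum.cong refl) (use f0 k in auto)
    then show ?thesis using k by simp
  qed
  \<comment> \<open>(m-1)(m-2) is non-zero for m at least 3. In a matrix c x x^T, non-zero diagonal
    entries at v and w force c, x_v and x_w to be non-zero, hence also the entry at v, w.\<close>
  have "calc ?f v v \<noteq> 0" "calc ?f w w \<noteq> 0"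
    using V card by (auto simp: calc_triangles near_def)
  then have "calc ?f v w \<noteq> 0" unfolding calc by simp
  then show ?thesis using V by (auto simp: calc_triangles)
qed

text \<open>Cliques of size 1 or 2 contribute nothing to \<open>sum_triangles_eq\<close>, and all
  vertices in larger ones share a single clique. With m its size, lam1 and m - 1 have the same value
  under x^3 - x.\<close>

lemma large_clique_cases:
  obtains (small) "lam1 = 1" "\<And>v. v \<in> verts G \<Longrightarrow> card (clique v) \<le> 2"
  | (large) a where "a \<in> verts G" "card (clique a) \<ge> 3" "lam1 = real (card (clique a)) - 1"
      "clique a = {v \<in> verts G. card (clique v) \<ge> 3}"
proof (cases "\<exists>a\<in>verts G. card (clique a) \<ge> 3")
  case False
  then have le: "card (clique v) \<le> 2" if "v \<in> verts G" for v using that by force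
  have "card (clique v) = 1 \<or> card (clique v) = 2" if "v \<in> verts G" for v
    using le[OF that] card_clique_pos[OF that] by linarith
  then have "(\<Sum>v\<in>verts G. (real (card (clique v)) - 1) * (real (card (clique v)) - 2)) = 0"
    by (intro sum.neutral) force
  then have "lam1 = 1" unfolding sum_triangles_eq using lam1_ge by simp
  then show ?thesis using small le by blast
next
  case True
  then obtain a where a: "a \<in> verts G" "card (clique a) \<ge> 3" by blast
  define m where "m = real (card (clique a))"
  have m: "m \<ge> 3" using a by (simp add: m_def)
  have clique_a: "clique v = clique a" if "v \<in> clique a" for v
    using that clique_eq[OF a(1), of v] by (simp add: clique_def[of a])
  have eq: "clique a = {v \<in> verts G. card (clique v) \<ge> 3}"
  proof (intro equalityI subsetI)
    fix v assume v: "v \<in> clique a"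
    then show "v \<in> {v \<in> verts G. card (clique v) \<ge> 3}"
      using clique_a[OF v] a(2) by (simp add: clique_def[of a])
  next
    fix v assume v: "v \<in> {v \<in> verts G. card (clique v) \<ge> 3}"
    then show "v \<in> clique a"
      using large_cliques_near[OF a(1), of v] a(2) by (simp add: clique_def[of a])
  qed
  have "(\<Sum>v\<in>verts G. (real (card (clique v)) - 1) * (real (card (clique v)) - 2))
      = (\<Sum>v\<in>clique a. (m - 1) * (m - 2))"
  proof (rule sum.mono_neutral_cong_right)
    show "\<forall>v\<in>verts G - clique a. (real (card (clique v)) - 1) * (real (card (clique v)) - 2) = 0"
    proof
      fix v assume v: "v \<in> verts G - clique a"
      then have "card (clique v) = 1 \<or> card (clique v) = 2"
        using card_clique_pos[of v] unfolding eq by force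
      then show "(real (card (clique v)) - 1) * (real (card (clique v)) - 2) = 0" by auto
    qed
    fix v assume "v \<in> clique a"
    then have "clique v = clique a" by (rule clique_a)
    then show "(real (card (clique v)) - 1) * (real (card (clique v)) - 2) = (m - 1) * (m - 2)"
      by (simp add: m_def)
  qed (use finite_verts in \<open>auto simp: clique_def\<close>)
  also have "\<dots> = m * (m - 1) * (m - 2)" by (simp add: m_def)
  finally have "(lam1 + 1) * lam1 * (lam1 - 1) = m * (m - 1) * (m - 2)"
    by (simp add: sum_triangles_eq)
  \<comment> \<open>With c = m - 1: (x^3 - x) - (c^3 - c) = (x - c)(x^2 + xc + c^2 - 1), and the
    second factor is positive for x at least 1 and c > 0.\<close>
  moreover have "(lam1 - (m - 1)) * (lam1\<^sup>2 + lam1 * (m - 1) + (m - 1)\<^sup>2 - 1)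
      = (lam1 + 1) * lam1 * (lam1 - 1) - m * (m - 1) * (m - 2)"
    by (simp add: power2_eq_square algebra_simps)
  moreover have "lam1\<^sup>2 + lam1 * (m - 1) + (m - 1)\<^sup>2 - 1 > 0"
  proof -
    have "lam1\<^sup>2 \<ge> 1" using lam1_ge by simp
    moreover have "lam1 * (m - 1) > 0" using lam1_ge m by simp
    ultimately show ?thesis using zero_le_power2[of "m - 1"] by linarith
  qed
  ultimately have "lam1 = m - 1" by simp
  then show ?thesis using large a eq m_def by blast
qed

text \<open>In \<open>sum_one_minus_square_eq\<close> the vertices in \<open>A2\<close> contribute 0
  and those in \<open>A1\<close> contribute 1 each, while the part of \<open>B\<close> cancels 1 -
  lam1^2. What remains equates isolated vertices with zero eigenvalues.\<close>

lemma card_small_cliques: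
  defines "B \<equiv> {v \<in> verts G. card (clique v) \<ge> 3}"
    and "A1 \<equiv> {v \<in> verts G. card (clique v) = 1}"
    and "A2 \<equiv> {v \<in> verts G. card (clique v) = 2}"
  shows "count (graph_eigenvalues G) 0 = card A1"
    and "card (verts G) = card B + card A1 + card A2"
    and "verts G = B \<union> (A1 \<union> A2)"
proof -
  have fin: "finite B" "finite A1" "finite A2"
    using finite_verts by (auto simp: B_def A1_def A2_def)
  have V: "verts G = B \<union> (A1 \<union> A2)"
    using card_clique_pos by (auto simp: B_def A1_def A2_def) force
  then show "verts G = B \<union> (A1 \<union> A2)" .
  have disj: "B \<inter> (A1 \<union> A2) = {}" "A1 \<inter> A2 = {}"
    by (auto simp: B_def A1_def A2_def)
  then show "card (verts G) = card B + card A1 + card A2"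
    unfolding V using fin by (simp add: card_Un_disjoint)
  have "(\<Sum>v\<in>verts G. 2 - real (card (clique v)))
      = (\<Sum>v\<in>B. 2 - real (card (clique v))) + card A1"
    unfolding V using fin disj by (simp add: sum.union_disjoint) (simp add: A1_def A2_def)
  \<comment> \<open>A large clique has m = lam1 + 1 vertices and contributes m(2 - m); without one,
    \<open>B\<close> is empty and lam1 = 1.\<close>
  moreover have "(\<Sum>v\<in>B. 2 - real (card (clique v))) = 1 - lam1\<^sup>2"
  proof (cases rule: large_clique_cases)
    case small
    then have "B = {}" by (force simp: B_def)
    then show ?thesis using small by simp
  next
    case (large a)
    have "card (clique v) = card (clique a)" if "v \<in> B" for v
    proof -
      have "v \<in> clique a" using that large(4) by (simp add: B_def)
      then show ?thesis using clique_eq[OF large(1)] by (auto simp: clique_def[of a])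
    qed
    then have "(\<Sum>v\<in>B. 2 - real (card (clique v))) = card B * (2 - real (card (clique a)))"
      by simp
    also have "card B = card (clique a)" using large(4) by (simp add: B_def)
    also have "real (card (clique a)) = lam1 + 1" using large(3) by simp
    also have "(lam1 + 1) * (2 - (lam1 + 1)) = 1 - lam1\<^sup>2"
      by (simp add: power2_eq_square algebra_simps)
    finally show ?thesis .
  qed
  ultimately have "count S 0 = card A1" unfolding sum_one_minus_square_eq by simp
  then show "count (graph_eigenvalues G) 0 = card A1"
    using lam1_ge by (simp add: eigenvalues)
qed

lemma not_edge_of_card_clique_neq:
  assumes "v \<in> verts G" "w \<in> verts G" "card (clique v) \<noteq> card (clique w)"
  shows "{v, w} \<notin> edges G"
  using assms clique_eq edge_iff_near by metis

lemma equality_graph: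
  defines "\<kappa> \<equiv> count (graph_eigenvalues G) 0" and "n \<equiv> card (verts G)"
  shows "lam1 = 1 \<Longrightarrow>
      G \<simeq>\<^sub>g ((n - \<kappa>) div 2) \<cdot>\<^sub>g complete_graph 2 \<uplus>\<^sub>g \<kappa> \<cdot>\<^sub>g complete_graph 1"
    and "lam1 > 1 \<Longrightarrow> \<exists>l. \<kappa> \<le> l \<and> l + 3 \<le> n \<and>
      G \<simeq>\<^sub>g complete_graph (n - l) \<uplus>\<^sub>g \<kappa> \<cdot>\<^sub>g complete_graph 1
        \<uplus>\<^sub>g ((l - \<kappa>) div 2) \<cdot>\<^sub>g complete_graph 2"
proof -
  define B where "B = {v \<in> verts G. card (clique v) \<ge> 3}"
  define A1 where "A1 = {v \<in> verts G. card (clique v) = 1}"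
  define A2 where "A2 = {v \<in> verts G. card (clique v) = 2}"
  note card = card_small_cliques[folded B_def A1_def A2_def \<kappa>_def n_def]
  have sub: "B \<subseteq> verts G" "A1 \<subseteq> verts G" "A2 \<subseteq> verts G"
    and disj: "A2 \<inter> A1 = {}" "A1 \<inter> A2 = {}" "B \<inter> (A1 \<union> A2) = {}"
    by (auto simp: B_def A1_def A2_def)
  have sep: "{v, w} \<notin> edges G" if "v \<in> A1 \<and> w \<in> A2 \<or> v \<in> A2 \<and> w \<in> A1 \<or> v \<in> B \<and> w \<in> A1 \<union> A2" for v w
    by (rule not_edge_of_card_clique_neq) (use that in \<open>auto simp: B_def A1_def A2_def\<close>)
  obtain t1 where "card A1 = t1 * 1" "G\<lparr>verts := A1\<rparr> \<simeq>\<^sub>g t1 \<cdot>\<^sub>g complete_graph 1"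
    using same_size_cliques_iso[OF A1_def] by blast
  then have iso1: "G\<lparr>verts := A1\<rparr> \<simeq>\<^sub>g \<kappa> \<cdot>\<^sub>g complete_graph 1" using card(1) by simp
  obtain t2 where t2: "card A2 = t2 * 2" and iso2: "G\<lparr>verts := A2\<rparr> \<simeq>\<^sub>g t2 \<cdot>\<^sub>g complete_graph 2"
    using same_size_cliques_iso[OF A2_def] by blast
  show "G \<simeq>\<^sub>g ((n - \<kappa>) div 2) \<cdot>\<^sub>g complete_graph 2 \<uplus>\<^sub>g \<kappa> \<cdot>\<^sub>g complete_graph 1" if "lam1 = 1"
  proof -
    have "B = {}"
      by (cases rule: large_clique_cases) (use that in \<open>force simp: B_def\<close>)+
    then have V: "verts G = A2 \<union> A1" and "(n - \<kappa>) div 2 = t2" using card t2 by auto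
    moreover have "G \<simeq>\<^sub>g t2 \<cdot>\<^sub>g complete_graph 2 \<uplus>\<^sub>g \<kappa> \<cdot>\<^sub>g complete_graph 1"
      by (rule graph_iso_disjoint_unionI[OF iso2 iso1 disj(1) V]) (use sep in blast)
    ultimately show ?thesis by simp
  qed
  show "\<exists>l. \<kappa> \<le> l \<and> l + 3 \<le> n \<and>
      G \<simeq>\<^sub>g complete_graph (n - l) \<uplus>\<^sub>g \<kappa> \<cdot>\<^sub>g complete_graph 1
        \<uplus>\<^sub>g ((l - \<kappa>) div 2) \<cdot>\<^sub>g complete_graph 2" if "lam1 > 1"
  proof (cases rule: large_clique_cases)
    case small
    then show ?thesis using that by simp
  next
    case (large a)
    have B: "B = clique a" using large(4) by (simp add: B_def)
    have "near v w" if "v \<in> B" "w \<in> B" for v w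
      using that large_cliques_near by (simp add: B_def)
    then have "G\<lparr>verts := B\<rparr> \<simeq>\<^sub>g complete_graph (card B)"
      using graph_iso_complete_graph[of "G\<lparr>verts := B\<rparr>"] finite_clique
      by (auto simp: B edge_iff_near)
    moreover have "G\<lparr>verts := A1 \<union> A2\<rparr> \<simeq>\<^sub>g \<kappa> \<cdot>\<^sub>g complete_graph 1 \<uplus>\<^sub>g t2 \<cdot>\<^sub>g complete_graph 2"
      by (rule graph_iso_disjoint_unionI[where A = A1 and B = A2]) (use iso1 iso2 disj sep in auto)
    ultimately have "G \<simeq>\<^sub>g complete_graph (card B) \<uplus>\<^sub>g \<kappa> \<cdot>\<^sub>g complete_graph 1 \<uplus>\<^sub>g t2 \<cdot>\<^sub>g complete_graph 2"
      by (rule graph_iso_disjoint_unionI[OF _ _ disj(3) card(3)]) (use sep in blast)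
    \<comment> \<open>The witness for l is the number of vertices outside the large clique. Since
      \<open>card A2\<close> is even, the division by 2 is exact.\<close>
    moreover have "n - (\<kappa> + card A2) = card B" "(\<kappa> + card A2 - \<kappa>) div 2 = t2" "\<kappa> + card A2 + 3 \<le> n"
      using card(1,2) t2 large(2) B by auto
    ultimately show ?thesis by (intro exI[of _ "\<kappa> + card A2"]) simp
  qed
qed

end

section \<open>The inequality and its case of equality\<close>

theorem theorem4:
  fixes G :: "'a graph" and n \<kappa> :: nat and lam1 :: real
  assumes "simple_graph G"
    and "card (verts G) = n"
    and "is_largest_eigenvalue G lam1"
    and "lam1 > 0"
    and "nullity G = \<kappa>"
  shows
    "energy G \<ge> lam1 + real n - real \<kappa> - 1 + ln \<bar>graph_Upsilon (n - \<kappa>) G\<bar> - ln lam1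
     \<and> (energy G = lam1 + real n - real \<kappa> - 1 + ln \<bar>graph_Upsilon (n - \<kappa>) G\<bar> - ln lam1
         \<longleftrightarrow> (\<forall>\<mu>\<in>#filter_mset (\<lambda>x. x \<noteq> 0) (graph_eigenvalues G) - {#lam1#}. \<bar>\<mu>\<bar> = 1))
     \<and> (energy G = lam1 + real n - real \<kappa> - 1 + ln \<bar>graph_Upsilon (n - \<kappa>) G\<bar> - ln lam1
         \<longrightarrow> (lam1 = 1 \<longrightarrow>
                G \<simeq>\<^sub>g ((n - \<kappa>) div 2) \<cdot>\<^sub>g complete_graph 2 \<uplus>\<^sub>g \<kappa> \<cdot>\<^sub>g complete_graph 1)
           \<and> (lam1 > 1 \<longrightarrow> (\<exists>l. \<kappa> \<le> l \<and> l + 3 \<le> n \<and>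
                G \<simeq>\<^sub>g complete_graph (n - l) \<uplus>\<^sub>g \<kappa> \<cdot>\<^sub>g complete_graph 1
                     \<uplus>\<^sub>g ((l - \<kappa>) div 2) \<cdot>\<^sub>g complete_graph 2)))"
proof -
  let ?nz = "filter_mset (\<lambda>x. x \<noteq> 0)"
  \<comment> \<open>\<open>R\<close> drops one copy of \<open>lam1\<close> but keeps the zeros, as
    the locale for the equality case expects; \<open>S\<close> below drops the zeros too.\<close>
  obtain R where R: "graph_eigenvalues G = add_mset lam1 R"
    using assms(3) by (auto simp: is_largest_eigenvalue_def dest: multi_member_split)
  define S where "S = ?nz R"
  have nz: "?nz (graph_eigenvalues G) = add_mset lam1 S"
    using \<open>lam1 > 0\<close> by (simp add: R S_def)
  have "size (graph_eigenvalues G) = size (?nz (graph_eigenvalues G)) + \<kappa>"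
    using assms(5) by (subst multiset_partition[of _ "\<lambda>x. x \<noteq> 0"])
      (simp add: nullity_def filter_eq_replicate_mset flip: count_filter_mset)
  \<comment> \<open>Thus n - \<kappa> - 1 is the number of factors in \<open>prod_mset S\<close>,
    one summand 1 for each use of the estimate.\<close>
  then have n: "n = size S + 1 + \<kappa>"
    using assms(2) size_graph_eigenvalues[of G] nz by simp
  then have "graph_Upsilon (n - \<kappa>) G = lam1 * prod_mset S"
    using Upsilon_eq_prod_nonzero_eigenvalues[of "adj_matrix G"] nz
    by (simp add: graph_Upsilon_def flip: graph_eigenvalues_def)
  moreover have "prod_mset S \<noteq> 0" by (simp add: S_def)
  \<comment> \<open>This \<open>ln lam1\<close> cancels the one subtracted in the bound, and
    \<open>lam1\<close> itself occurs on both sides: the claim concerns \<open>S\<close>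
    alone.\<close>
  ultimately have ln: "ln \<bar>graph_Upsilon (n - \<kappa>) G\<bar> = ln lam1 + ln \<bar>prod_mset S\<bar>"
    using \<open>lam1 > 0\<close> by (simp add: abs_mult ln_mult)
  have "(\<Sum>\<mu>\<in>#R. \<bar>\<mu>\<bar>) = (\<Sum>\<mu>\<in>#S. \<bar>\<mu>\<bar>)"
    unfolding S_def by (induction R) auto
  then have energy: "energy G = lam1 + (\<Sum>\<mu>\<in>#S. \<bar>\<mu>\<bar>)"
    using \<open>lam1 > 0\<close> by (simp add: energy_def R)
  have "\<forall>\<mu>\<in>#S. \<mu> \<noteq> 0" by (simp add: S_def)
  note le = size_plus_ln_prod_mset_le[OF this]
  let ?eq = "energy G = lam1 + real n - real \<kappa> - 1 + ln \<bar>graph_Upsilon (n - \<kappa>) G\<bar> - ln lam1"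
  have "energy G \<ge> lam1 + real n - real \<kappa> - 1 + ln \<bar>graph_Upsilon (n - \<kappa>) G\<bar> - ln lam1"
    using le unfolding ln energy by (simp add: n)
  moreover have eq: "?eq \<longleftrightarrow> (\<forall>\<mu>\<in>#S. \<bar>\<mu>\<bar> = 1)"
    using le unfolding ln energy by (auto simp: n)
  moreover have "graph_spectrum_equality G es u lam1 R" if "?eq" "lam1 \<ge> 1" "graph_spectrum G es u" for es u
  proof -
    interpret graph_spectrum G es u by fact
    show ?thesis
      using that R eq by unfold_locales (auto simp: S_def abs_if split: if_splits)
  qed
  moreover obtain es u where "graph_spectrum G es u"
    using graph_spectrum_exists[OF assms(1)] .
  ultimately show ?thesis
    using graph_spectrum_equality.equality_graph[of G es u lam1 R] assms(2,5)
    unfolding nz nullity_def by auto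
qed

end
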